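(* For every even integer $n\geq 4$, the wheel graph with $n$ spokes is isomorphic to the reduced clique graph $C_R(G)$ of some chordal graph $G$.
   Context: All graphs are finite and simple. For an integer $n\geq 3$, the wheel graph with $n$ spokes is obtained from a cycle of $n$ vertices by adding a new vertex and making it adjacent to all vertices of the cycle. A graph is chordal if every cycle with at least four vertices has a chord (an edge joining two vertices of the cycle that is not in the cycle). A clique is a set of pairwise adjacent vertices; maximal cliques are maximal with respect to inclusion. For a set $S$ of vertices, a path is $S$-avoiding if no internal vertex of the path is in $S$. The reduced clique graph $C_R(G)$ of a chordal graph $G$ has the maximal cliques of $G$ as its vertices; distinct maximal cliques $C$ and $C'$ are adjacent in $C_R(G)$ if and only if $C\cap C'\neq\emptyset$ and $C,C'$ form a separating pair, meaning that there is no $(C\cap C')$-avoiding path of $G$ from a vertex in $C-C'$ to a vertex in $C'-C$. *)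

theory Defs
  imports "Graph_Theory.Graph_Theory"
begin

text \<open>
  A finite simple graph is a \<^locale>\<open>pair_graph\<close>: a finite vertex set with a symmetric, irreflexive
  set of arcs, each edge being represented by its two orientations.
\<close>

text \<open>The rim is the cycle \<open>0, 1, \<dots>, n - 1\<close> and \<open>n\<close> is the hub; meant for \<open>n \<ge> 3\<close>.\<close>

definition wheel_graph :: "nat \<Rightarrow> nat pair_pre_digraph" where
  "wheel_graph n =
     \<lparr> pverts = {0..n},
       parcs = {(i, j). i < n \<and> j < n \<and> (j = Suc i mod n \<or> i = Suc j mod n)}
               \<union> {(i, n) | i. i < n} \<union> {(n, i) | i. i < n} \<rparr>"

lemma pair_graph_wheel_graph:
  assumes "n \<ge> 3"
  shows "pair_graph (wheel_graph n)"
proof -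
  have fin: "finite (parcs (wheel_graph n))"
    by (rule finite_subset[of _ "{0..n} \<times> {0..n}"]) (auto simp: wheel_graph_def)
  have ne: "Suc i mod n \<noteq> i" if "i < n" for i
    using that assms by (cases "Suc i = n") auto
  from fin ne ne[symmetric] show ?thesis
    by unfold_locales (auto simp: wheel_graph_def symmetric_def sym_def)
qed

text \<open>
  A cycle is given by its list of arcs. In a simple graph, the degenerate closed walks
  \<open>a, b, a\<close> that \<^const>\<open>pre_digraph.cycle\<close> admits have length 2, so they are excluded by the
  length condition.
\<close>

definition chordal :: "'a pair_pre_digraph \<Rightarrow> bool" where
  "chordal G \<longleftrightarrow>
     (\<forall>p. pre_digraph.cycle (with_proj G) p \<and> length p \<ge> 4 \<longrightarrow>
        (\<exists>x \<in> fst ` set p. \<exists>y \<in> fst ` set p.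
           (x, y) \<in> parcs G \<and> (x, y) \<notin> set p \<and> (y, x) \<notin> set p))"

definition clique :: "'a pair_pre_digraph \<Rightarrow> 'a set \<Rightarrow> bool" where
  "clique G C \<longleftrightarrow> C \<subseteq> pverts G \<and> (\<forall>x \<in> C. \<forall>y \<in> C. x \<noteq> y \<longrightarrow> (x, y) \<in> parcs G)"

definition maximal_clique :: "'a pair_pre_digraph \<Rightarrow> 'a set \<Rightarrow> bool" where
  "maximal_clique G C \<longleftrightarrow> clique G C \<and> (\<forall>D. clique G D \<and> C \<subseteq> D \<longrightarrow> D = C)"

definition avoiding_path ::
    "'a pair_pre_digraph \<Rightarrow> 'a set \<Rightarrow> 'a \<Rightarrow> ('a \<times> 'a) list \<Rightarrow> 'a \<Rightarrow> bool" where
  "avoiding_path G S u p v \<longleftrightarrow>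
     pre_digraph.apath (with_proj G) u p v \<and>
     set (pre_digraph.inner_verts (with_proj G) p) \<inter> S = {}"

definition separating_pair :: "'a pair_pre_digraph \<Rightarrow> 'a set \<Rightarrow> 'a set \<Rightarrow> bool" where
  "separating_pair G C C' \<longleftrightarrow>
     \<not> (\<exists>u \<in> C - C'. \<exists>v \<in> C' - C. \<exists>p. avoiding_path G (C \<inter> C') u p v)"

definition reduced_clique_graph :: "'a pair_pre_digraph \<Rightarrow> 'a set pair_pre_digraph" where
  "reduced_clique_graph G =
     \<lparr> pverts = {C. maximal_clique G C},
       parcs = {(C, C'). maximal_clique G C \<and> maximal_clique G C' \<and> C \<noteq> C' \<and>
                         C \<inter> C' \<noteq> {} \<and> separating_pair G C C'} \<rparr>"

end

theory Submission
  imports Defs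
begin

text \<open>
  Take a clique \<open>K\<close> and proper nonempty subsets \<open>S\<^sub>i\<close> of it, and attach to \<open>K\<close>, for each \<open>i\<close>, one
  new vertex \<open>v\<^sub>i\<close> whose neighbourhood is \<open>S\<^sub>i\<close>. The result is a split graph, hence chordal: a long
  cycle never visits two of the \<open>v\<^sub>i\<close> in succession, so it contains a vertex whose two neighbours on
  the cycle both lie in \<open>K\<close>, and these form a chord. Its maximal cliques are \<open>K\<close> and the sets
  \<open>C\<^sub>i = S\<^sub>i \<union> {v\<^sub>i}\<close>.

  The reduced clique graph can be read off from inclusions. The clique \<open>K\<close> is adjacent to every
  \<open>C\<^sub>i\<close>, because all neighbours of \<open>v\<^sub>i\<close> lie in \<open>K \<inter> C\<^sub>i = S\<^sub>i\<close>. If \<open>S\<^sub>i \<subseteq> S\<^sub>j\<close>, then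
  \<open>C\<^sub>i \<inter> C\<^sub>j = S\<^sub>i\<close> separates \<open>v\<^sub>i\<close> from everything else, so \<open>C\<^sub>i\<close> and \<open>C\<^sub>j\<close> are adjacent; and if
  \<open>S\<^sub>i\<close> and \<open>S\<^sub>j\<close> are incomparable, then an edge of \<open>K\<close> from \<open>S\<^sub>i - S\<^sub>j\<close> to \<open>S\<^sub>j - S\<^sub>i\<close> avoids
  \<open>C\<^sub>i \<inter> C\<^sub>j\<close>, so they are not adjacent. Hence the reduced clique graph is the comparability graph of
  the family \<open>S\<close> together with a vertex adjacent to everything, which becomes the hub.

  It remains to realise the cycle with \<open>n\<close> vertices as the comparability graph of proper nonempty
  subsets of a set. This is where evenness enters: orient the cycle so that even vertices lie below
  their odd neighbours, and represent each vertex by its down-set, which is \<open>{i}\<close> for even \<open>i\<close> and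
  \<open>{i - 1, i, i + 1}\<close> (modulo \<open>n\<close>) for odd \<open>i\<close>. These are proper subsets because \<open>n > 3\<close>.
\<close>

section \<open>Cycles and avoiding paths\<close>

lemma pcas_ends:
  assumes "pcas u p v" "p \<noteq> []"
  shows "fst (hd p) = u" "snd (last p) = v"
  using assms by (induction u p v rule: pcas.induct) (auto split: if_splits)

lemma pcas_consecutive:
  assumes "pcas u p v" "Suc i < length p"
  shows "fst (p ! Suc i) = snd (p ! i)"
  using assms
proof (induction u p v arbitrary: i rule: pcas.induct)
  case (2 u e p v)
  show ?case
  proof (cases i)
    case 0
    then show ?thesis using 2 pcas_ends(1)[of "snd e" p v] by (cases p) auto
  next
    case (Suc j)
    then show ?thesis using 2 by auto
  qed
qed simp

lemma cycle_arcs_successive: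
  assumes "pre_digraph.cycle (with_proj G) p"
  shows "distinct (map fst p)"
    and "i < length p \<Longrightarrow> snd (p ! i) = fst (p ! (Suc i mod length p))"
    and "set p \<subseteq> parcs G"
proof -
  interpret pair_pre_digraph G .
  obtain u where w: "awalk u p u" and d: "distinct (tl (pawalk_verts u p))" and ne: "p \<noteq> []"
    using assms unfolding cycle_def by auto
  have c: "pcas u p u" using w by (simp add: awalk_def)
  have ends: "fst (hd p) = u" "snd (last p) = u"
    using pcas_ends[OF c ne] by auto
  have "tl (pawalk_verts u p) = rotate1 (map fst p)"
    using ne ends by (cases p) (auto simp: awalk_verts_conv)
  then show "distinct (map fst p)" using d by (metis distinct1_rotate)
  show "set p \<subseteq> parcs G" using w by (simp add: awalk_def)
  assume i: "i < length p"
  show "snd (p ! i) = fst (p ! (Suc i mod length p))"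
  proof (cases "Suc i < length p")
    case True
    then show ?thesis using pcas_consecutive[OF c] by simp
  next
    case False
    then have "Suc i = length p" using i by simp
    moreover from this have "last p = p ! i" using ne by (metis diff_Suc_1 last_conv_nth)
    ultimately show ?thesis using ends ne by (simp add: hd_conv_nth)
  qed
qed

text \<open>
  Each vertex of a cycle is the tail of exactly one of its arcs, so the arcs of a cycle join only
  vertices at cyclic distance one. Length at least four makes distance two different from distance
  one in either direction: in a triangle, two steps forward are one step back. So any adjacency
  between vertices two steps apart is a chord.
\<close>

lemma cycle_no_arc_at_distance_two:
  assumes cyc: "pre_digraph.cycle (with_proj G) p"
    and len: "length p \<ge> 4"
    and a: "a < length p"
  defines "b \<equiv> (a + 2) mod length p"
  shows "fst (p ! a) \<noteq> fst (p ! b)"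
    and "(fst (p ! a), fst (p ! b)) \<notin> set p"
    and "(fst (p ! b), fst (p ! a)) \<notin> set p"
proof -
  let ?l = "length p"
  have l0: "0 < ?l" using len by linarith
  have b_cases: "b = (if a + 2 < ?l then a + 2 else a + 2 - ?l)"
    using a len by (simp add: b_def le_mod_geq)
  have Suc_cases: "Suc i mod ?l = (if Suc i = ?l then 0 else Suc i)" if "i < ?l" for i
    using that by (simp add: mod_Suc)
  have b: "b < ?l" using l0 unfolding b_def by simp
  have inj: "i = j" if "fst (p ! i) = fst (p ! j)" "i < ?l" "j < ?l" for i j
    using cycle_arcs_successive(1)[OF cyc] that by (auto simp: distinct_conv_nth)
  have arc: "j = Suc i mod ?l" if ij: "(fst (p ! i), fst (p ! j)) \<in> set p" "i < ?l" "j < ?l" for i j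
  proof -
    obtain k where k: "k < ?l" "p ! k = (fst (p ! i), fst (p ! j))"
      using ij(1) unfolding in_set_conv_nth by blast
    then have "k = i" using inj[of k i] ij by simp
    have "snd (p ! k) = fst (p ! j)" using k(2) by simp
    then have "fst (p ! j) = fst (p ! (Suc i mod ?l))"
      using cycle_arcs_successive(2)[OF cyc k(1)] \<open>k = i\<close> by simp
    then show ?thesis by (rule inj) (use ij l0 in simp_all)
  qed
  show "fst (p ! a) \<noteq> fst (p ! b)"
    using inj[OF _ a b] a len b_cases by (auto split: if_splits)
  show "(fst (p ! a), fst (p ! b)) \<notin> set p"
    using arc[OF _ a b] a len b_cases Suc_cases[OF a] by (auto split: if_splits)
  show "(fst (p ! b), fst (p ! a)) \<notin> set p"
    using arc[OF _ b a] a len b_cases Suc_cases[OF b] by (auto split: if_splits)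
qed

lemma avoiding_pathD:
  assumes "avoiding_path G S u p v"
  shows "set p \<subseteq> parcs G" "pcas u p v" "set (tl (map fst p)) \<inter> S = {}"
  using assms
  by (auto simp: avoiding_path_def pre_digraph.apath_def pre_digraph.awalk_def
      inner_verts_with_proj_def cas_with_proj_eq)

text \<open>
  If all neighbours of \<open>u\<close> lie in \<open>S\<close>, then the second vertex of any path leaving \<open>u\<close> lies in \<open>S\<close>, so
  an \<open>S\<close>-avoiding path has to stop there. The two versions treat the start and the end of a path.
\<close>

lemma avoiding_path_from_enclosed:
  assumes p: "avoiding_path G S u p v"
    and nbrs: "\<And>w. (u, w) \<in> parcs G \<Longrightarrow> w \<in> S"
  shows "v = u \<or> v \<in> S"
proof (cases p)
  case Nil
  then show ?thesis using avoiding_pathD(2)[OF p] by simp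
next
  case (Cons e q)
  then have "snd e \<in> S" "pcas (snd e) q v"
    using avoiding_pathD[OF p] nbrs[of "snd e"] by (cases e; auto)+
  then show ?thesis using avoiding_pathD(3)[OF p] Cons by (cases q) auto
qed

lemma avoiding_path_to_enclosed:
  assumes p: "avoiding_path G S u p v"
    and nbrs: "\<And>w. (w, v) \<in> parcs G \<Longrightarrow> w \<in> S"
  shows "u = v \<or> u \<in> S"
proof (cases p rule: rev_cases)
  case Nil
  then show ?thesis using avoiding_pathD(2)[OF p] by simp
next
  case (snoc q e)
  have "snd e = v" using pcas_ends(2)[OF avoiding_pathD(2)[OF p]] snoc by simp
  then have "fst e \<in> S" using avoiding_pathD(1)[OF p] nbrs[of "fst e"] snoc by (cases e) auto
  then show ?thesis using avoiding_pathD(2,3)[OF p] snoc by (cases q) auto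
qed

section \<open>A clique with attached vertices\<close>

text \<open>
  The core clique is \<open>{..<k}\<close>; for \<open>i < m\<close> the vertex \<open>k + i\<close> is attached to the subset \<open>S i\<close> of the
  core. Nonemptiness of \<open>S i\<close> makes the maximal clique of \<open>k + i\<close> meet the core, and properness keeps
  the core itself a maximal clique.
\<close>

locale clique_with_pendants =
  fixes k m :: nat and S :: "nat \<Rightarrow> nat set"
  assumes attach: "i < m \<Longrightarrow> S i \<noteq> {} \<and> S i \<subset> {..<k}"
begin

definition G :: "nat pair_pre_digraph" where
  "G = \<lparr> pverts = {..<k + m},
         parcs = {(x, y). x < k \<and> y < k \<and> x \<noteq> y}
                 \<union> {(x, k + i) | x i. i < m \<and> x \<in> S i}
                 \<union> {(k + i, x) | x i. i < m \<and> x \<in> S i} \<rparr>"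

definition C :: "nat \<Rightarrow> nat set" where
  "C i = insert (k + i) (S i)"

lemma attach_core: "i < m \<Longrightarrow> x \<in> S i \<Longrightarrow> x < k"
  using attach[of i] by auto

lemma arc_core: "x < k \<Longrightarrow> y < k \<Longrightarrow> (x, y) \<in> parcs G \<longleftrightarrow> x \<noteq> y"
  by (auto simp: G_def)

lemma arc_pendant:
  assumes "i < m"
  shows "(k + i, y) \<in> parcs G \<longleftrightarrow> y \<in> S i"
    and "(y, k + i) \<in> parcs G \<longleftrightarrow> y \<in> S i"
  using assms attach_core by (fastforce simp: G_def)+

lemma arc_meets_core:
  assumes "(x, y) \<in> parcs G"
  shows "x < k \<or> y < k"
  using assms attach_core by (auto simp: G_def)

lemma pverts_cases:
  assumes "x \<in> pverts G"
  obtains "x < k" | i where "i < m" "x = k + i"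
proof (cases "x < k")
  case False
  then have "x - k < m" "x = k + (x - k)" using assms by (auto simp: G_def)
  then show ?thesis by (rule that(2))
qed (rule that(1))

lemma pair_graph_G: "pair_graph G"
proof -
  have fin: "finite (parcs G)"
    by (rule finite_subset[of _ "{..<k + m} \<times> {..<k + m}"]) (auto simp: G_def dest: attach_core)
  show ?thesis
    by unfold_locales
      (use fin in \<open>auto simp: G_def symmetric_def sym_def dest: attach_core\<close>)
qed

text \<open>
  On a cycle of length at least four, some two vertices at distance two both lie in the core: the
  two neighbours of a vertex outside the core if there is one, any two otherwise. They are adjacent
  and form a chord.
\<close>

lemma chordal_G: "chordal G"
  unfolding chordal_def
proof (intro allI impI, elim conjE)
  fix p assume cyc: "pre_digraph.cycle (with_proj G) p" and len: "length p \<ge> 4"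
  let ?l = "length p" and ?w = "\<lambda>i. fst (p ! i)"
  have l0: "0 < ?l" using len by linarith
  have arc: "(?w i, ?w (Suc i mod ?l)) \<in> parcs G" if "i < ?l" for i
    using cycle_arcs_successive(2,3)[OF cyc] that nth_mem[OF that]
    by (metis prod.collapse subsetD)
  obtain a where a: "a < ?l" "?w a < k" "?w ((a + 2) mod ?l) < k"
  proof (cases "\<forall>i < ?l. ?w i < k")
    case True
    then show ?thesis using that[of 0] len l0 by simp
  next
    case False
    then obtain c where c: "c < ?l" "\<not> ?w c < k" by auto
    \<comment> \<open>\<open>a\<close> is the cyclic predecessor of \<open>c\<close>; adding the length first avoids truncation at \<open>c = 0\<close>.\<close>
    define a where "a = (c + ?l - 1) mod ?l"
    have a: "a < ?l" using l0 by (simp add: a_def)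
    have sa: "Suc a mod ?l = c"
      using c l0 by (simp add: a_def mod_Suc_eq)
    have "(a + 2) mod ?l = Suc (Suc a mod ?l) mod ?l" by (simp add: mod_Suc_eq)
    then have "(a + 2) mod ?l = Suc c mod ?l" using sa by simp
    then show ?thesis
      using that[OF a] arc_meets_core[OF arc[OF a]] arc_meets_core[OF arc[OF c(1)]] c sa by simp
  qed
  let ?b = "(a + 2) mod ?l"
  have "?b < ?l" using l0 by simp
  then have "?w a \<in> fst ` set p" "?w ?b \<in> fst ` set p" using a(1) by simp_all
  moreover have "(?w a, ?w ?b) \<in> parcs G"
    using a arc_core cycle_no_arc_at_distance_two(1)[OF cyc len a(1)] by simp
  ultimately show "\<exists>x \<in> fst ` set p. \<exists>y \<in> fst ` set p.
      (x, y) \<in> parcs G \<and> (x, y) \<notin> set p \<and> (y, x) \<notin> set p"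
    using cycle_no_arc_at_distance_two(2,3)[OF cyc len a(1)] by blast
qed

lemma clique_cases:
  assumes "clique G D"
  obtains "D \<subseteq> {..<k}" | i where "i < m" "D \<subseteq> C i"
proof (cases "D \<subseteq> {..<k}")
  case False
  then obtain x where x: "x \<in> D" "\<not> x < k" by auto
  moreover have "x \<in> pverts G" using assms x by (auto simp: clique_def)
  ultimately obtain i where i: "i < m" "x = k + i" by (auto elim: pverts_cases)
  have "D \<subseteq> C i"
  proof
    fix y assume "y \<in> D"
    then have "y = k + i \<or> (k + i, y) \<in> parcs G" using assms x(1) i(2) by (auto simp: clique_def)
    then show "y \<in> C i" using arc_pendant(1)[OF i(1)] by (auto simp: C_def)
  qed
  then show ?thesis using i that by blast
qed (rule that(1))

lemma clique_core: "clique G {..<k}"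
  by (auto simp: clique_def G_def)

lemma clique_C: "i < m \<Longrightarrow> clique G (C i)"
  using attach_core arc_pendant arc_core by (fastforce simp: clique_def C_def G_def)

lemma core_not_subset_C: "i < m \<Longrightarrow> \<not> {..<k} \<subseteq> C i"
  using attach[of i] by (auto simp: C_def)

lemma C_subset_iff:
  assumes "i < m" "j < m"
  shows "C i \<subseteq> C j \<longleftrightarrow> i = j"
  using assms attach_core by (fastforce simp: C_def)

lemma maximal_clique_iff: "maximal_clique G D \<longleftrightarrow> D = {..<k} \<or> (\<exists>i < m. D = C i)"
proof
  assume D: "maximal_clique G D"
  then have "clique G D" by (simp add: maximal_clique_def)
  then show "D = {..<k} \<or> (\<exists>i < m. D = C i)"
    using D clique_core clique_C by (cases rule: clique_cases) (auto simp: maximal_clique_def)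
next
  assume "D = {..<k} \<or> (\<exists>i < m. D = C i)"
  then show "maximal_clique G D"
  proof (elim disjE exE conjE)
    assume D: "D = {..<k}"
    have "E = {..<k}" if "clique G E" "{..<k} \<subseteq> E" for E
      using that(1) by (cases rule: clique_cases) (use that core_not_subset_C in blast)+
    then show ?thesis using clique_core by (simp add: maximal_clique_def D)
  next
    fix i assume i: "i < m" and D: "D = C i"
    have "E = C i" if E: "clique G E" "C i \<subseteq> E" for E
      using E(1)
    proof (cases rule: clique_cases)
      case 1
      then show ?thesis using E(2) by (auto simp: C_def)
    next
      case (2 j)
      then show ?thesis using E(2) C_subset_iff[OF i 2(1)] by blast
    qed
    then show ?thesis using clique_C[OF i] by (simp add: maximal_clique_def D)
  qed
qed

text \<open>
  If \<open>S i \<subseteq> D\<close> and \<open>k + i \<notin> D\<close>, then \<open>C i \<inter> D\<close> is the whole neighbourhood of \<open>k + i\<close>, which is the only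
  vertex of \<open>C i - D\<close>. This serves both for the core and for a clique \<open>C j\<close> with \<open>S i \<subseteq> S j\<close>.
\<close>

lemma separating_pair_enclosing:
  assumes i: "i < m" and S: "S i \<subseteq> D" and v: "k + i \<notin> D"
  shows "separating_pair G (C i) D" and "separating_pair G D (C i)"
proof -
  have int: "C i \<inter> D = S i" "D \<inter> C i = S i" and diff: "C i - D = {k + i}"
    using S v by (auto simp: C_def)
  show "separating_pair G (C i) D"
    unfolding separating_pair_def diff int
    using avoiding_path_from_enclosed[of G "S i" "k + i"] arc_pendant[OF i] by (auto simp: C_def)
  show "separating_pair G D (C i)"
    unfolding separating_pair_def diff int
    using avoiding_path_to_enclosed[of G "S i" _ _ "k + i"] arc_pendant[OF i] by (auto simp: C_def)
qed

text \<open>The avoiding path is a single edge of the core, which has no internal vertices at all.\<close>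

lemma not_separating_pair_incomparable:
  assumes "i < m" "j < m" "\<not> S i \<subseteq> S j" "\<not> S j \<subseteq> S i"
  shows "\<not> separating_pair G (C i) (C j)"
proof -
  obtain x y where xy: "x \<in> S i" "x \<notin> S j" "y \<in> S j" "y \<notin> S i" using assms by auto
  then have k: "x < k" "y < k" using attach_core assms by blast+
  then have "(x, y) \<in> parcs G" "x \<noteq> y" using arc_core xy by auto
  then have "avoiding_path G (C i \<inter> C j) x [(x, y)] y"
    using k by (auto simp: avoiding_path_def pre_digraph.apath_def pre_digraph.awalk_def
        inner_verts_with_proj_def cas_with_proj_eq awalk_verts_with_proj_eq G_def)
  moreover have "x \<in> C i - C j" "y \<in> C j - C i" using xy k by (auto simp: C_def)
  ultimately show ?thesis unfolding separating_pair_def by blast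
qed

lemma C_Int:
  assumes "i < m" "j < m" "i \<noteq> j"
  shows "C i \<inter> C j = S i \<inter> S j"
  using assms attach_core by (fastforce simp: C_def)

lemma pverts_reduced: "pverts (reduced_clique_graph G) = insert {..<k} (C ` {..<m})"
  by (auto simp: reduced_clique_graph_def maximal_clique_iff)

lemma reduced_arc_C_C:
  assumes "i < m" "j < m"
  shows "(C i, C j) \<in> parcs (reduced_clique_graph G) \<longleftrightarrow> i \<noteq> j \<and> (S i \<subseteq> S j \<or> S j \<subseteq> S i)"
proof (cases "i = j")
  case True
  then show ?thesis by (simp add: reduced_clique_graph_def)
next
  case False
  have v: "k + i \<notin> C j" "k + j \<notin> C i" using assms False attach_core by (fastforce simp: C_def)+
  then have "C i \<noteq> C j" by (auto simp: C_def)
  have "separating_pair G (C i) (C j) \<longleftrightarrow> S i \<subseteq> S j \<or> S j \<subseteq> S i"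
    using separating_pair_enclosing(1)[OF assms(1) _ v(1)]
      separating_pair_enclosing(2)[OF assms(2) _ v(2)]
      not_separating_pair_incomparable[OF assms] by (auto simp: C_def)
  moreover have "S i \<inter> S j \<noteq> {}" if "S i \<subseteq> S j \<or> S j \<subseteq> S i"
    using that attach[OF assms(1)] attach[OF assms(2)] by auto
  ultimately show ?thesis
    using assms False \<open>C i \<noteq> C j\<close> C_Int[OF assms False]
    by (auto simp: reduced_clique_graph_def maximal_clique_iff)
qed

lemma reduced_arc_core:
  assumes "i < m"
  shows "(C i, {..<k}) \<in> parcs (reduced_clique_graph G)"
    and "({..<k}, C i) \<in> parcs (reduced_clique_graph G)"
proof -
  have "S i \<subseteq> {..<k}" "k + i \<notin> {..<k}" using attach[OF assms] by auto
  note sep = separating_pair_enclosing[OF assms this]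
  have "C i \<noteq> {..<k}" "C i \<inter> {..<k} \<noteq> {}" using attach[OF assms] by (auto simp: C_def)
  then show "(C i, {..<k}) \<in> parcs (reduced_clique_graph G)"
    and "({..<k}, C i) \<in> parcs (reduced_clique_graph G)"
    using assms sep by (auto simp: reduced_clique_graph_def maximal_clique_iff)
qed

end

section \<open>The wheel\<close>

lemma digraph_iso_with_projI:
  assumes G: "wf_digraph (with_proj G)"
    and bij: "bij_betw f (pverts G) (pverts H)"
    and sub: "parcs H \<subseteq> pverts H \<times> pverts H"
    and arcs: "\<And>x y. x \<in> pverts G \<Longrightarrow> y \<in> pverts G \<Longrightarrow> (f x, f y) \<in> parcs H \<longleftrightarrow> (x, y) \<in> parcs G"
  shows "digraph_iso (with_proj G) (with_proj H)"
proof -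
  interpret wf_digraph "with_proj G" by fact
  let ?h = "\<lparr> iso_verts = f, iso_arcs = map_prod f f, iso_head = snd, iso_tail = fst \<rparr>"
  have ends: "parcs G \<subseteq> pverts G \<times> pverts G" using wellformed by (fastforce simp: with_proj_def)
  have inj: "inj_on f (pverts G)" using bij by (simp add: bij_betw_def)
  have "inj_on (map_prod f f) (parcs G)"
    using map_prod_inj_on[OF inj inj] ends by (rule inj_on_subset)
  then have "digraph_isomorphism ?h"
    using inj by (simp add: digraph_isomorphism_def wf_digraph_axioms)
  moreover have "parcs H = map_prod f f ` parcs G"
  proof
    show "parcs H \<subseteq> map_prod f f ` parcs G"
    proof
      fix e assume e: "e \<in> parcs H"
      then obtain x y where "x \<in> pverts G" "y \<in> pverts G" "e = (f x, f y)"
        using sub bij_betw_imp_surj_on[OF bij] by blast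
      then show "e \<in> map_prod f f ` parcs G" using arcs e by (intro image_eqI[of _ _ "(x, y)"]) auto
    qed
    show "map_prod f f ` parcs G \<subseteq> parcs H" using arcs ends by auto
  qed
  then have "with_proj H = app_iso ?h (with_proj G)"
    using bij by (simp add: app_iso_def with_proj_def bij_betw_def)
  ultimately show ?thesis unfolding digraph_iso_def by blast
qed

abbreviation rim_adjacent :: "nat \<Rightarrow> nat \<Rightarrow> nat \<Rightarrow> bool" where
  "rim_adjacent n i j \<equiv> j = Suc i mod n \<or> i = Suc j mod n"

text \<open>
  Ordering the rim so that every even vertex lies below its two odd neighbours makes this the set of
  vertices at or below \<open>i\<close>.
\<close>

definition rim_downset :: "nat \<Rightarrow> nat \<Rightarrow> nat set" where
  "rim_downset n i = insert i {j. j < n \<and> odd i \<and> rim_adjacent n i j}"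

text \<open>
  The only place where the parity of \<open>n\<close> matters: it makes the rim bipartite, since reduction modulo
  an even \<open>n\<close> preserves parity.
\<close>

lemma rim_adjacent_parity:
  assumes "even n" "rim_adjacent n i j"
  shows "even i \<longleftrightarrow> odd j"
  using assms by (auto simp: dvd_mod_iff)

text \<open>
  As \<open>i\<close> belongs to its own down-set, inclusion of down-sets is the order itself; an odd \<open>i\<close> lies below
  no other vertex, because it is neither in the singleton of an even vertex nor adjacent to an odd one.
\<close>

lemma rim_downset_comparable_iff:
  assumes "even n" "i < n" "j < n"
  shows "i \<noteq> j \<and> (rim_downset n i \<subseteq> rim_downset n j \<or> rim_downset n j \<subseteq> rim_downset n i)
    \<longleftrightarrow> rim_adjacent n i j"
proof -
  have up: "rim_downset n i \<subseteq> rim_downset n j \<longleftrightarrow> i = j \<or> (odd j \<and> rim_adjacent n i j)"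
    if "i < n" "j < n" for i j
    using that rim_adjacent_parity[OF assms(1)] by (auto simp: rim_downset_def)
  show ?thesis
    using up[OF assms(2,3)] up[OF assms(3,2)] rim_adjacent_parity[OF assms(1), of i j] by auto
qed

text \<open>
  A down-set has at most three elements. Here \<open>i - 1\<close> is the predecessor of \<open>i\<close> also in truncated
  subtraction, as only odd \<open>i\<close> have neighbours in their down-set.
\<close>

lemma rim_downset_psubset:
  assumes "n \<ge> 4" "i < n"
  shows "rim_downset n i \<subset> {..<n}"
proof -
  have "rim_downset n i \<subseteq> {i, Suc i mod n, i - 1}"
    by (auto simp: rim_downset_def mod_Suc split: if_splits)
  then have "card (rim_downset n i) \<le> card {i, Suc i mod n, i - 1}" by (intro card_mono) auto
  also have "\<dots> \<le> 3" by (simp add: card_insert_if)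
  finally have "card (rim_downset n i) \<le> 3" .
  then have "card (rim_downset n i) \<noteq> card {..<n}" using assms(1) by simp
  then have "rim_downset n i \<noteq> {..<n}" by metis
  moreover have "rim_downset n i \<subseteq> {..<n}" using assms by (auto simp: rim_downset_def)
  ultimately show ?thesis by blast
qed

theorem proposition3p4:
  fixes n :: nat
  assumes "even n" and "n \<ge> 4"
  shows "\<exists>G :: nat pair_pre_digraph. pair_graph G \<and> chordal G \<and>
           digraph_iso (with_proj (wheel_graph n)) (with_proj (reduced_clique_graph G))"
proof -
  interpret clique_with_pendants n n "rim_downset n"
    by unfold_locales (use rim_downset_psubset[OF assms(2)] in \<open>auto simp: rim_downset_def\<close>)
  interpret W: pair_graph "wheel_graph n" using assms pair_graph_wheel_graph by simp
  let ?R = "reduced_clique_graph G"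
  define f where "f i = (if i < n then C i else {..<n})" for i
  have f: "i < n \<Longrightarrow> f i = C i" "f n = {..<n}" for i by (auto simp: f_def)
  have verts: "pverts (wheel_graph n) = insert n {..<n}" by (auto simp: wheel_graph_def)
  have "inj_on f (insert n {..<n})"
    using C_subset_iff core_not_subset_C by (auto simp: inj_on_def f)
  moreover have "f ` insert n {..<n} = pverts ?R" by (auto simp: pverts_reduced f)
  ultimately have bij: "bij_betw f (pverts (wheel_graph n)) (pverts ?R)"
    unfolding verts bij_betw_def by simp
  have arcs: "(f x, f y) \<in> parcs ?R \<longleftrightarrow> (x, y) \<in> parcs (wheel_graph n)"
    if "x \<in> pverts (wheel_graph n)" "y \<in> pverts (wheel_graph n)" for x y
  proof -
    consider "x < n" "y < n" | "x < n" "y = n" | "x = n" "y < n" | "x = n" "y = n"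
      using \<open>x \<in> _\<close> \<open>y \<in> _\<close> unfolding verts by auto
    then show ?thesis
    proof cases
      case 1
      then have "(f x, f y) \<in> parcs ?R \<longleftrightarrow> rim_adjacent n x y"
        unfolding f(1)[OF 1(1)] f(1)[OF 1(2)] reduced_arc_C_C[OF 1]
        by (rule rim_downset_comparable_iff[OF assms(1)])
      then show ?thesis using 1 by (simp add: wheel_graph_def)
    next
      case 4
      then show ?thesis by (simp add: f wheel_graph_def reduced_clique_graph_def)
    qed (use reduced_arc_core in \<open>auto simp: f wheel_graph_def\<close>)
  qed
  have "digraph_iso (with_proj (wheel_graph n)) (with_proj ?R)"
    by (rule digraph_iso_with_projI[OF W.wf_digraph_axioms bij _ arcs])
      (auto simp: reduced_clique_graph_def)
  then show ?thesis using pair_graph_G chordal_G by blast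
qed

end
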